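(* Let $G$ be a group with identity $e$, and let $\varphi:G\to Z(G)$ be a homomorphism, where $Z(G)$ is the center of $G$. (1) Let $X$ be a group with a right action of $G$, and denote by $x^g$ the result of $g\in G$ acting on $x\in X$. Define binary operations $\underline{*}^g,\overline{*}^g:X\times X\to X$ ($g\in G$) by $$x\underline{*}^gy=(xy^{-1})^g\,y^{\varphi(g)},\qquad x\overline{*}^gy=x^{\varphi(g)}.$$ Then $X$ is a $G$-family of biquandles (called a $G$-family of generalized Alexander biquandles). (2) Let $R$ be a ring and $X$ a right $R[G]$-module, where $R[G]$ is the group ring of $G$ over $R$. Define binary operations $\underline{*}^g,\overline{*}^g:X\times X\to X$ ($g\in G$) by $$x\underline{*}^gy=xg+y(\varphi(g)-g),\qquad x\overline{*}^gy=x\varphi(g).$$ Then $X$ is a $G$-family of biquandles (called a $G$-family of Alexander biquandles).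
   Context: For a group $G$ with identity $e$, a $G$-family of biquandles is a non-empty set $X$ with two families of binary operations $\underline{*}^g,\overline{*}^g:X\times X\to X$ ($g\in G$) such that for all $x,y,z\in X$ and $g,h\in G$: - $(x\underline{*}^gy)\underline{*}^h(z\overline{*}^gy)=(x\underline{*}^hz)\underline{*}^{h^{-1}gh}(y\underline{*}^hz)$, - $(x\overline{*}^gy)\underline{*}^h(z\overline{*}^gy)=(x\underline{*}^hz)\overline{*}^{h^{-1}gh}(y\underline{*}^hz)$, - $(x\overline{*}^gy)\overline{*}^h(z\overline{*}^gy)=(x\overline{*}^hz)\overline{*}^{h^{-1}gh}(y\underline{*}^hz)$, - $x\underline{*}^{gh}y=(x\underline{*}^gy)\underline{*}^h(y\underline{*}^gy)$ and $x\underline{*}^ey=x$, - $x\overline{*}^{gh}y=(x\overline{*}^gy)\overline{*}^h(y\overline{*}^gy)$ and $x\overline{*}^ey=x$, - $x\underline{*}^gx=x\overline{*}^gx$. *)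

theory Defs
  imports "HOL-Algebra.Ring"
begin

definition group_center :: "('g, 'm) monoid_scheme \<Rightarrow> 'g set" where
  "group_center G =
     {z \<in> carrier G. \<forall>g \<in> carrier G. z \<otimes>\<^bsub>G\<^esub> g = g \<otimes>\<^bsub>G\<^esub> z}"

text \<open>
  \<open>under g x y\<close> and \<open>over g x y\<close> are the results of the lower and the upper operation
  with index \<open>g\<close>; they are operations on the set \<open>X\<close>, so closure is assumed and the
  identities are required on \<open>X\<close> only.
\<close>

locale G_family_of_biquandles = group G
  for G :: "('g, 'm) monoid_scheme" (structure) +
  fixes X :: "'x set"
    and under over :: "'g \<Rightarrow> 'x \<Rightarrow> 'x \<Rightarrow> 'x"
  assumes nonempty: "X \<noteq> {}"
    and under_closed:
      "\<lbrakk>g \<in> carrier G; x \<in> X; y \<in> X\<rbrakk> \<Longrightarrow> under g x y \<in> X"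
    and over_closed:
      "\<lbrakk>g \<in> carrier G; x \<in> X; y \<in> X\<rbrakk> \<Longrightarrow> over g x y \<in> X"
    and under_under:
      "\<lbrakk>g \<in> carrier G; h \<in> carrier G; x \<in> X; y \<in> X; z \<in> X\<rbrakk> \<Longrightarrow>
       under h (under g x y) (over g z y) =
       under (inv h \<otimes> g \<otimes> h) (under h x z) (under h y z)"
    and over_under:
      "\<lbrakk>g \<in> carrier G; h \<in> carrier G; x \<in> X; y \<in> X; z \<in> X\<rbrakk> \<Longrightarrow>
       under h (over g x y) (over g z y) =
       over (inv h \<otimes> g \<otimes> h) (under h x z) (under h y z)"
    and over_over:
      "\<lbrakk>g \<in> carrier G; h \<in> carrier G; x \<in> X; y \<in> X; z \<in> X\<rbrakk> \<Longrightarrow>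
       over h (over g x y) (over g z y) =
       over (inv h \<otimes> g \<otimes> h) (over h x z) (under h y z)"
    and under_mult:
      "\<lbrakk>g \<in> carrier G; h \<in> carrier G; x \<in> X; y \<in> X\<rbrakk> \<Longrightarrow>
       under (g \<otimes> h) x y = under h (under g x y) (under g y y)"
    and under_one:
      "\<lbrakk>x \<in> X; y \<in> X\<rbrakk> \<Longrightarrow> under \<one> x y = x"
    and over_mult:
      "\<lbrakk>g \<in> carrier G; h \<in> carrier G; x \<in> X; y \<in> X\<rbrakk> \<Longrightarrow>
       over (g \<otimes> h) x y = over h (over g x y) (over g y y)"
    and over_one:
      "\<lbrakk>x \<in> X; y \<in> X\<rbrakk> \<Longrightarrow> over \<one> x y = x"
    and under_over_diag:
      "\<lbrakk>g \<in> carrier G; x \<in> X\<rbrakk> \<Longrightarrow> under g x x = over g x x"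

text \<open>
  A right action of a group \<open>G\<close> on a group \<open>X\<close> is an action by group automorphisms, as
  usual for an action on an object of the category of groups; \<open>act x g\<close> is \<open>x\<close> to the
  power \<open>g\<close>.  (For a mere action on the underlying set the diagonal axiom
  \<open>under_over_diag\<close> can fail for generalized Alexander biquandles, as it needs
  \<open>act \<one> g = \<one>\<close>.)  Bijectivity of each \<open>\<lambda>x. act x g\<close> follows from the first three axioms.
\<close>

locale right_action_on_group = G: group G + X: group X
  for G :: "('g, 'm) monoid_scheme" and X :: "('x, 'n) monoid_scheme" +
  fixes act :: "'x \<Rightarrow> 'g \<Rightarrow> 'x"
  assumes act_closed:
      "\<lbrakk>x \<in> carrier X; g \<in> carrier G\<rbrakk> \<Longrightarrow> act x g \<in> carrier X"
    and act_one: "x \<in> carrier X \<Longrightarrow> act x \<one>\<^bsub>G\<^esub> = x"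
    and act_mult:
      "\<lbrakk>x \<in> carrier X; g \<in> carrier G; h \<in> carrier G\<rbrakk> \<Longrightarrow>
       act x (g \<otimes>\<^bsub>G\<^esub> h) = act (act x g) h"
    and act_hom:
      "\<lbrakk>x \<in> carrier X; y \<in> carrier X; g \<in> carrier G\<rbrakk> \<Longrightarrow>
       act (x \<otimes>\<^bsub>X\<^esub> y) g = act x g \<otimes>\<^bsub>X\<^esub> act y g"

text \<open>
  Unital right modules over a not necessarily commutative ring.  As in the library's locale
  \<open>module\<close> (left modules over commutative rings), only the additive part of the ring
  record \<open>M\<close> is used.
\<close>

locale right_module = R: ring R + M: abelian_group M
  for R :: "('r, 'm) ring_scheme" and M :: "('x, 'n) ring_scheme" +
  fixes rsmult :: "'x \<Rightarrow> 'r \<Rightarrow> 'x"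
  assumes rsmult_closed:
      "\<lbrakk>x \<in> carrier M; a \<in> carrier R\<rbrakk> \<Longrightarrow> rsmult x a \<in> carrier M"
    and rsmult_add_right:
      "\<lbrakk>x \<in> carrier M; a \<in> carrier R; b \<in> carrier R\<rbrakk> \<Longrightarrow>
       rsmult x (a \<oplus>\<^bsub>R\<^esub> b) = rsmult x a \<oplus>\<^bsub>M\<^esub> rsmult x b"
    and rsmult_add_left:
      "\<lbrakk>x \<in> carrier M; y \<in> carrier M; a \<in> carrier R\<rbrakk> \<Longrightarrow>
       rsmult (x \<oplus>\<^bsub>M\<^esub> y) a = rsmult x a \<oplus>\<^bsub>M\<^esub> rsmult y a"
    and rsmult_mult:
      "\<lbrakk>x \<in> carrier M; a \<in> carrier R; b \<in> carrier R\<rbrakk> \<Longrightarrow>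
       rsmult x (a \<otimes>\<^bsub>R\<^esub> b) = rsmult (rsmult x a) b"
    and rsmult_one: "x \<in> carrier M \<Longrightarrow> rsmult x \<one>\<^bsub>R\<^esub> = x"

text \<open>
  The basis element of \<open>R[G]\<close> given by a group element; where the mathematics writes
  \<open>g\<close> for an element of \<open>R[G]\<close>, \<open>gr_elem R G g\<close> is meant.
\<close>

definition gr_elem :: "('r, 'm) ring_scheme \<Rightarrow> ('g, 'n) monoid_scheme \<Rightarrow> 'g \<Rightarrow> 'g \<Rightarrow> 'r" where
  "gr_elem R G g = (\<lambda>k \<in> carrier G. if k = g then \<one>\<^bsub>R\<^esub> else \<zero>\<^bsub>R\<^esub>)"

text \<open>
  The group ring: finitely supported functions from \<open>G\<close> to \<open>R\<close> (extensional, so that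
  equality of elements is equality of functions) with pointwise addition and convolution.
\<close>

definition group_ring :: "('r, 'm) ring_scheme \<Rightarrow> ('g, 'n) monoid_scheme \<Rightarrow> ('g \<Rightarrow> 'r) ring" where
  "group_ring R G =
     \<lparr>carrier = {f \<in> carrier G \<rightarrow>\<^sub>E carrier R. finite {g \<in> carrier G. f g \<noteq> \<zero>\<^bsub>R\<^esub>}},
      mult = (\<lambda>f h. \<lambda>k \<in> carrier G.
        \<Oplus>\<^bsub>R\<^esub>a \<in> {a \<in> carrier G. f a \<noteq> \<zero>\<^bsub>R\<^esub>}. f a \<otimes>\<^bsub>R\<^esub> h (inv\<^bsub>G\<^esub> a \<otimes>\<^bsub>G\<^esub> k)),
      one = gr_elem R G \<one>\<^bsub>G\<^esub>,
      zero = (\<lambda>k \<in> carrier G. \<zero>\<^bsub>R\<^esub>),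
      add = (\<lambda>f h. \<lambda>k \<in> carrier G. f k \<oplus>\<^bsub>R\<^esub> h k)\<rparr>"


text \<open>
  The rest shows that \<open>group_ring R G\<close> is a ring, so that the assumption \<open>ring R\<close> of
  \<open>right_module\<close> always holds for it, and that \<open>gr_elem\<close> is multiplicative.
\<close>

lemma (in abelian_monoid) finsum_swap:
  assumes "finite A" "finite B" "\<And>a b. \<lbrakk>a \<in> A; b \<in> B\<rbrakk> \<Longrightarrow> f a b \<in> carrier G"
  shows "(\<Oplus>a\<in>A. \<Oplus>b\<in>B. f a b) = (\<Oplus>b\<in>B. \<Oplus>a\<in>A. f a b)"
  using assms(1,3)
proof (induction A rule: finite_induct)
  case empty
  then show ?case by (simp add: finsum_zero)
next
  case (insert c A)
  have "(\<Oplus>a\<in>insert c A. \<Oplus>b\<in>B. f a b) = (\<Oplus>b\<in>B. f c b) \<oplus> (\<Oplus>a\<in>A. \<Oplus>b\<in>B. f a b)"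
    using insert by (intro finsum_insert) (auto intro!: finsum_closed)
  also have "\<dots> = (\<Oplus>b\<in>B. f c b) \<oplus> (\<Oplus>b\<in>B. \<Oplus>a\<in>A. f a b)"
    using insert by simp
  also have "\<dots> = (\<Oplus>b\<in>B. f c b \<oplus> (\<Oplus>a\<in>A. f a b))"
    using insert by (intro finsum_addf[symmetric]) (auto intro!: finsum_closed)
  also have "\<dots> = (\<Oplus>b\<in>B. \<Oplus>a\<in>insert c A. f a b)"
    using insert by (intro finsum_cong') (auto intro!: finsum_closed finsum_insert[symmetric])
  finally show ?case .
qed

lemma group_ring_mult_eq:
  assumes "ring R" "group G"
    and f: "f \<in> carrier (group_ring R G)" and h: "h \<in> carrier (group_ring R G)"
    and A: "finite A" "A \<subseteq> carrier G" "{a \<in> carrier G. f a \<noteq> \<zero>\<^bsub>R\<^esub>} \<subseteq> A"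
    and k: "k \<in> carrier G"
  shows "(f \<otimes>\<^bsub>group_ring R G\<^esub> h) k =
    (\<Oplus>\<^bsub>R\<^esub>a \<in> A. f a \<otimes>\<^bsub>R\<^esub> h (inv\<^bsub>G\<^esub> a \<otimes>\<^bsub>G\<^esub> k))"
proof -
  interpret R: ring R by fact
  interpret G: group G by fact
  have fc: "f a \<in> carrier R" "h a \<in> carrier R" if "a \<in> carrier G" for a
    using f h that by (auto simp: group_ring_def)
  have "(\<Oplus>\<^bsub>R\<^esub>a \<in> {a \<in> carrier G. f a \<noteq> \<zero>\<^bsub>R\<^esub>}. f a \<otimes>\<^bsub>R\<^esub> h (inv\<^bsub>G\<^esub> a \<otimes>\<^bsub>G\<^esub> k)) =
    (\<Oplus>\<^bsub>R\<^esub>a \<in> A. f a \<otimes>\<^bsub>R\<^esub> h (inv\<^bsub>G\<^esub> a \<otimes>\<^bsub>G\<^esub> k))"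
    using A k by (intro R.add.finprod_mono_neutral_cong_left) (auto simp: fc subset_iff)
  then show ?thesis using k by (simp add: group_ring_def)
qed

lemma group_ring_mult_closed:
  assumes "ring R" "group G"
    and f: "f \<in> carrier (group_ring R G)" and h: "h \<in> carrier (group_ring R G)"
  shows "f \<otimes>\<^bsub>group_ring R G\<^esub> h \<in> carrier (group_ring R G)"
proof -
  interpret R: ring R by fact
  interpret G: group G by fact
  have fc: "f a \<in> carrier R" "h a \<in> carrier R" if "a \<in> carrier G" for a
    using f h that by (auto simp: group_ring_def)
  let ?F = "{a \<in> carrier G. f a \<noteq> \<zero>\<^bsub>R\<^esub>}" and ?H = "{a \<in> carrier G. h a \<noteq> \<zero>\<^bsub>R\<^esub>}"
  let ?P = "(\<lambda>(a, b). a \<otimes>\<^bsub>G\<^esub> b) ` (?F \<times> ?H)"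
  have fin: "finite ?F" "finite ?H" using f h by (auto simp: group_ring_def)
  have "(f \<otimes>\<^bsub>group_ring R G\<^esub> h) k = \<zero>\<^bsub>R\<^esub>" if k: "k \<in> carrier G" "k \<notin> ?P" for k
  proof -
    have "h (inv\<^bsub>G\<^esub> a \<otimes>\<^bsub>G\<^esub> k) = \<zero>\<^bsub>R\<^esub>" if a: "a \<in> ?F" for a
    proof (rule ccontr)
      assume "h (inv\<^bsub>G\<^esub> a \<otimes>\<^bsub>G\<^esub> k) \<noteq> \<zero>\<^bsub>R\<^esub>"
      then have "(a, inv\<^bsub>G\<^esub> a \<otimes>\<^bsub>G\<^esub> k) \<in> ?F \<times> ?H" using a k by auto
      moreover have "a \<otimes>\<^bsub>G\<^esub> (inv\<^bsub>G\<^esub> a \<otimes>\<^bsub>G\<^esub> k) = k"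
        using a k by (simp add: G.m_assoc[symmetric])
      ultimately have "k \<in> ?P" by (metis (mono_tags, lifting) case_prod_conv image_eqI)
      then show False using k by simp
    qed
    then have "(\<Oplus>\<^bsub>R\<^esub>a \<in> ?F. f a \<otimes>\<^bsub>R\<^esub> h (inv\<^bsub>G\<^esub> a \<otimes>\<^bsub>G\<^esub> k)) = \<zero>\<^bsub>R\<^esub>"
      by (intro R.add.finprod_one_eqI) (auto simp: fc)
    then show ?thesis using k by (simp add: group_ring_def)
  qed
  then have "{k \<in> carrier G. (f \<otimes>\<^bsub>group_ring R G\<^esub> h) k \<noteq> \<zero>\<^bsub>R\<^esub>} \<subseteq> ?P" by blast
  moreover have "finite ?P" using fin by simp
  ultimately have "finite {k \<in> carrier G. (f \<otimes>\<^bsub>group_ring R G\<^esub> h) k \<noteq> \<zero>\<^bsub>R\<^esub>}"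
    by (rule finite_subset)
  moreover have "f \<otimes>\<^bsub>group_ring R G\<^esub> h \<in> carrier G \<rightarrow>\<^sub>E carrier R"
    by (auto simp: group_ring_def fc intro!: R.finsum_closed)
  ultimately show ?thesis by (simp add: group_ring_def)
qed

lemma gr_elem_closed:
  assumes "ring R"
  shows "gr_elem R G g \<in> carrier (group_ring R G)"
proof -
  interpret R: ring R by fact
  have "{k \<in> carrier G. gr_elem R G g k \<noteq> \<zero>\<^bsub>R\<^esub>} \<subseteq> {g}"
    by (auto simp: gr_elem_def)
  then have "finite {k \<in> carrier G. gr_elem R G g k \<noteq> \<zero>\<^bsub>R\<^esub>}"
    by (rule finite_subset) simp
  then show ?thesis by (auto simp: group_ring_def gr_elem_def)
qed

lemma gr_elem_mult_left:
  assumes "ring R" "group G" and g: "g \<in> carrier G" and h: "h \<in> carrier (group_ring R G)"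
    and k: "k \<in> carrier G"
  shows "(gr_elem R G g \<otimes>\<^bsub>group_ring R G\<^esub> h) k = h (inv\<^bsub>G\<^esub> g \<otimes>\<^bsub>G\<^esub> k)"
proof -
  interpret R: ring R by fact
  interpret G: group G by fact
  have "h (inv\<^bsub>G\<^esub> g \<otimes>\<^bsub>G\<^esub> k) \<in> carrier R"
    using g h k by (auto simp: group_ring_def)
  moreover have "(gr_elem R G g \<otimes>\<^bsub>group_ring R G\<^esub> h) k =
    (\<Oplus>\<^bsub>R\<^esub>a \<in> {g}. gr_elem R G g a \<otimes>\<^bsub>R\<^esub> h (inv\<^bsub>G\<^esub> a \<otimes>\<^bsub>G\<^esub> k))"
    using assms by (intro group_ring_mult_eq gr_elem_closed) (auto simp: gr_elem_def)
  ultimately show ?thesis using g k by (simp add: gr_elem_def)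
qed

lemma gr_elem_mult:
  assumes "ring R" "group G" and g: "g \<in> carrier G" and h: "h \<in> carrier G"
  shows "gr_elem R G g \<otimes>\<^bsub>group_ring R G\<^esub> gr_elem R G h = gr_elem R G (g \<otimes>\<^bsub>G\<^esub> h)"
    (is "?l = ?r")
proof (rule extensionalityI[of _ "carrier G"])
  interpret G: group G by fact
  show "?l \<in> extensional (carrier G)" "?r \<in> extensional (carrier G)"
    by (auto simp: group_ring_def gr_elem_def)
  fix k assume k: "k \<in> carrier G"
  have "?l k = gr_elem R G h (inv\<^bsub>G\<^esub> g \<otimes>\<^bsub>G\<^esub> k)"
    using assms k by (intro gr_elem_mult_left gr_elem_closed)
  moreover have "inv\<^bsub>G\<^esub> g \<otimes>\<^bsub>G\<^esub> k = h \<longleftrightarrow> k = g \<otimes>\<^bsub>G\<^esub> h"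
    using g h k G.inv_solve_left[of h g k] by auto
  ultimately show "?l k = ?r k" using g h k by (simp add: gr_elem_def)
qed

lemma group_ring_is_ring:
  assumes "ring R" "group G"
  shows "ring (group_ring R G)" (is "ring ?S")
proof (rule ringI)
  interpret R: ring R by fact
  interpret G: group G by fact
  have val: "f a \<in> carrier R" if "f \<in> carrier ?S" "a \<in> carrier G" for f a
    using that by (auto simp: group_ring_def)
  have ext: "f \<in> extensional (carrier G)" if "f \<in> carrier ?S" for f
    using that by (auto simp: group_ring_def PiE_def)
  have supp: "finite {a \<in> carrier G. f a \<noteq> \<zero>\<^bsub>R\<^esub>}" if "f \<in> carrier ?S" for f
    using that by (auto simp: group_ring_def)
  have add: "(f \<oplus>\<^bsub>?S\<^esub> h) k = f k \<oplus>\<^bsub>R\<^esub> h k" if "k \<in> carrier G" for f h k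
    using that by (simp add: group_ring_def)
  note mult = group_ring_mult_eq[OF assms]
  note multc = group_ring_mult_closed[OF assms]
  have addc: "f \<oplus>\<^bsub>?S\<^esub> h \<in> carrier ?S" if "f \<in> carrier ?S" "h \<in> carrier ?S" for f h
  proof -
    have "{a \<in> carrier G. (f \<oplus>\<^bsub>?S\<^esub> h) a \<noteq> \<zero>\<^bsub>R\<^esub>} \<subseteq>
      {a \<in> carrier G. f a \<noteq> \<zero>\<^bsub>R\<^esub>} \<union> {a \<in> carrier G. h a \<noteq> \<zero>\<^bsub>R\<^esub>}"
      by (auto simp: add)
    then have "finite {a \<in> carrier G. (f \<oplus>\<^bsub>?S\<^esub> h) a \<noteq> \<zero>\<^bsub>R\<^esub>}"
      by (rule finite_subset) (simp add: supp that)
    moreover have "f \<oplus>\<^bsub>?S\<^esub> h \<in> carrier G \<rightarrow>\<^sub>E carrier R"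
      using that by (auto simp: group_ring_def)
    ultimately show ?thesis by (simp add: group_ring_def)
  qed
  have eqI: "f = h" if "f \<in> carrier ?S" "h \<in> carrier ?S" "\<And>k. k \<in> carrier G \<Longrightarrow> f k = h k" for f h
    using that ext extensionalityI by blast
  show "abelian_group ?S"
  proof (rule abelian_groupI)
    show zero: "\<zero>\<^bsub>?S\<^esub> \<in> carrier ?S" by (auto simp: group_ring_def)
    fix f assume f: "f \<in> carrier ?S"
    show "\<zero>\<^bsub>?S\<^esub> \<oplus>\<^bsub>?S\<^esub> f = f"
      using f zero by (intro eqI addc) (auto simp: add val group_ring_def)
    let ?n = "\<lambda>k \<in> carrier G. \<ominus>\<^bsub>R\<^esub> f k"
    have "{a \<in> carrier G. ?n a \<noteq> \<zero>\<^bsub>R\<^esub>} \<subseteq> {a \<in> carrier G. f a \<noteq> \<zero>\<^bsub>R\<^esub>}" by auto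
    then have "finite {a \<in> carrier G. ?n a \<noteq> \<zero>\<^bsub>R\<^esub>}"
      by (rule finite_subset) (simp add: supp f)
    then have n: "?n \<in> carrier ?S" using f by (auto simp: group_ring_def)
    moreover have "?n \<oplus>\<^bsub>?S\<^esub> f = \<zero>\<^bsub>?S\<^esub>"
      using f n zero by (intro eqI addc) (auto simp: add val R.l_neg, auto simp: group_ring_def)
    ultimately show "\<exists>n \<in> carrier ?S. n \<oplus>\<^bsub>?S\<^esub> f = \<zero>\<^bsub>?S\<^esub>" by blast
  next
    fix f h l assume "f \<in> carrier ?S" "h \<in> carrier ?S" "l \<in> carrier ?S"
    then show "f \<oplus>\<^bsub>?S\<^esub> h \<oplus>\<^bsub>?S\<^esub> l = f \<oplus>\<^bsub>?S\<^esub> (h \<oplus>\<^bsub>?S\<^esub> l)"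
      by (intro eqI addc) (auto simp: add val R.a_assoc)
  next
    fix f h assume "f \<in> carrier ?S" "h \<in> carrier ?S"
    then show "f \<oplus>\<^bsub>?S\<^esub> h = h \<oplus>\<^bsub>?S\<^esub> f"
      by (intro eqI addc) (auto simp: add val R.a_comm)
  qed (rule addc)
  have one: "\<one>\<^bsub>?S\<^esub> = gr_elem R G \<one>\<^bsub>G\<^esub>" by (simp add: group_ring_def)
  show "Group.monoid ?S"
  proof (rule monoidI)
    show "\<one>\<^bsub>?S\<^esub> \<in> carrier ?S" by (simp add: one gr_elem_closed assms)
    fix f assume f: "f \<in> carrier ?S"
    show "\<one>\<^bsub>?S\<^esub> \<otimes>\<^bsub>?S\<^esub> f = f"
      using f by (intro eqI multc) (auto simp: one gr_elem_closed gr_elem_mult_left assms)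
    show "f \<otimes>\<^bsub>?S\<^esub> \<one>\<^bsub>?S\<^esub> = f"
    proof (intro eqI multc f)
      show "\<one>\<^bsub>?S\<^esub> \<in> carrier ?S" by (simp add: one gr_elem_closed assms)
      fix k assume k: "k \<in> carrier G"
      let ?A = "insert k {a \<in> carrier G. f a \<noteq> \<zero>\<^bsub>R\<^esub>}"
      have "(f \<otimes>\<^bsub>?S\<^esub> \<one>\<^bsub>?S\<^esub>) k =
        (\<Oplus>\<^bsub>R\<^esub>a \<in> ?A. f a \<otimes>\<^bsub>R\<^esub> gr_elem R G \<one>\<^bsub>G\<^esub> (inv\<^bsub>G\<^esub> a \<otimes>\<^bsub>G\<^esub> k))"
        using f k unfolding one by (intro mult gr_elem_closed) (auto simp: supp assms)
      also have "\<dots> = (\<Oplus>\<^bsub>R\<^esub>a \<in> ?A. if k = a then f a else \<zero>\<^bsub>R\<^esub>)"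
      proof (rule R.finsum_cong')
        fix a assume "a \<in> ?A"
        then have a: "a \<in> carrier G" using k by auto
        have "inv\<^bsub>G\<^esub> a \<otimes>\<^bsub>G\<^esub> k = \<one>\<^bsub>G\<^esub> \<longleftrightarrow> k = a"
          using a k G.inv_solve_left[of "\<one>\<^bsub>G\<^esub>" a k] by auto
        then show "f a \<otimes>\<^bsub>R\<^esub> gr_elem R G \<one>\<^bsub>G\<^esub> (inv\<^bsub>G\<^esub> a \<otimes>\<^bsub>G\<^esub> k) =
            (if k = a then f a else \<zero>\<^bsub>R\<^esub>)"
          using a k f val[OF f a] by (simp add: gr_elem_def)
      qed (use f k in \<open>auto simp: val\<close>)
      also have "\<dots> = f k"
        using f k by (intro R.finsum_singleton) (auto simp: supp val)
      finally show "(f \<otimes>\<^bsub>?S\<^esub> \<one>\<^bsub>?S\<^esub>) k = f k" .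
    qed
  next
    fix f h l assume S: "f \<in> carrier ?S" "h \<in> carrier ?S" "l \<in> carrier ?S"
    let ?F = "{a \<in> carrier G. f a \<noteq> \<zero>\<^bsub>R\<^esub>}" and ?H = "{a \<in> carrier G. h a \<noteq> \<zero>\<^bsub>R\<^esub>}"
    define B where "B = {a \<in> carrier G. (f \<otimes>\<^bsub>?S\<^esub> h) a \<noteq> \<zero>\<^bsub>R\<^esub>} \<union>
      (\<lambda>(a, b). a \<otimes>\<^bsub>G\<^esub> b) ` (?F \<times> ?H)"
    have B: "finite B" "B \<subseteq> carrier G" using S supp multc by (auto simp: B_def)
    have FH: "finite ?F" "finite ?H" using S supp by auto
    show "f \<otimes>\<^bsub>?S\<^esub> h \<otimes>\<^bsub>?S\<^esub> l = f \<otimes>\<^bsub>?S\<^esub> (h \<otimes>\<^bsub>?S\<^esub> l)"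
    proof (intro eqI multc S)
      fix k assume k: "k \<in> carrier G"
      have "(f \<otimes>\<^bsub>?S\<^esub> h \<otimes>\<^bsub>?S\<^esub> l) k =
        (\<Oplus>\<^bsub>R\<^esub>b\<in>B. (f \<otimes>\<^bsub>?S\<^esub> h) b \<otimes>\<^bsub>R\<^esub> l (inv\<^bsub>G\<^esub> b \<otimes>\<^bsub>G\<^esub> k))"
        using S k B by (intro mult multc) (auto simp: B_def)
      also have "\<dots> = (\<Oplus>\<^bsub>R\<^esub>b\<in>B. \<Oplus>\<^bsub>R\<^esub>a\<in>?F. f a \<otimes>\<^bsub>R\<^esub> (h (inv\<^bsub>G\<^esub> a \<otimes>\<^bsub>G\<^esub> b) \<otimes>\<^bsub>R\<^esub> l (inv\<^bsub>G\<^esub> b \<otimes>\<^bsub>G\<^esub> k)))"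
      proof (rule R.finsum_cong')
        fix b assume "b \<in> B"
        then have b: "b \<in> carrier G" using B by auto
        have "(f \<otimes>\<^bsub>?S\<^esub> h) b = (\<Oplus>\<^bsub>R\<^esub>a\<in>?F. f a \<otimes>\<^bsub>R\<^esub> h (inv\<^bsub>G\<^esub> a \<otimes>\<^bsub>G\<^esub> b))"
          using S b FH by (intro mult) auto
        then have "(f \<otimes>\<^bsub>?S\<^esub> h) b \<otimes>\<^bsub>R\<^esub> l (inv\<^bsub>G\<^esub> b \<otimes>\<^bsub>G\<^esub> k) =
          (\<Oplus>\<^bsub>R\<^esub>a\<in>?F. f a \<otimes>\<^bsub>R\<^esub> h (inv\<^bsub>G\<^esub> a \<otimes>\<^bsub>G\<^esub> b) \<otimes>\<^bsub>R\<^esub> l (inv\<^bsub>G\<^esub> b \<otimes>\<^bsub>G\<^esub> k))"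
          using S b k FH by (simp, intro R.finsum_ldistr) (auto simp: val)
        also have "\<dots> = (\<Oplus>\<^bsub>R\<^esub>a\<in>?F. f a \<otimes>\<^bsub>R\<^esub> (h (inv\<^bsub>G\<^esub> a \<otimes>\<^bsub>G\<^esub> b) \<otimes>\<^bsub>R\<^esub> l (inv\<^bsub>G\<^esub> b \<otimes>\<^bsub>G\<^esub> k)))"
          using S b k by (intro R.finsum_cong') (auto simp: val R.m_assoc)
        finally show "(f \<otimes>\<^bsub>?S\<^esub> h) b \<otimes>\<^bsub>R\<^esub> l (inv\<^bsub>G\<^esub> b \<otimes>\<^bsub>G\<^esub> k) = \<dots>" .
      qed (use S k B in \<open>auto simp: val subset_iff intro!: R.finsum_closed\<close>)
      also have "\<dots> = (\<Oplus>\<^bsub>R\<^esub>a\<in>?F. \<Oplus>\<^bsub>R\<^esub>b\<in>B. f a \<otimes>\<^bsub>R\<^esub> (h (inv\<^bsub>G\<^esub> a \<otimes>\<^bsub>G\<^esub> b) \<otimes>\<^bsub>R\<^esub> l (inv\<^bsub>G\<^esub> b \<otimes>\<^bsub>G\<^esub> k)))"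
        using S k B FH by (intro R.finsum_swap) (auto simp: val subset_iff)
      also have "\<dots> = (\<Oplus>\<^bsub>R\<^esub>a\<in>?F. f a \<otimes>\<^bsub>R\<^esub> (h \<otimes>\<^bsub>?S\<^esub> l) (inv\<^bsub>G\<^esub> a \<otimes>\<^bsub>G\<^esub> k))"
      proof (rule R.finsum_cong')
        fix a assume aF: "a \<in> ?F"
        then have a: "a \<in> carrier G" by auto
        have inj: "inj_on (\<lambda>b. inv\<^bsub>G\<^esub> a \<otimes>\<^bsub>G\<^esub> b) B"
          using a B by (auto simp: inj_on_def subset_iff)
        have sub: "?H \<subseteq> (\<lambda>b. inv\<^bsub>G\<^esub> a \<otimes>\<^bsub>G\<^esub> b) ` B"
        proof
          fix c assume c: "c \<in> ?H"
          then have "a \<otimes>\<^bsub>G\<^esub> c \<in> B" using aF by (force simp: B_def)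
          moreover have "c = inv\<^bsub>G\<^esub> a \<otimes>\<^bsub>G\<^esub> (a \<otimes>\<^bsub>G\<^esub> c)"
            using a c by (simp add: G.m_assoc[symmetric])
          ultimately show "c \<in> (\<lambda>b. inv\<^bsub>G\<^esub> a \<otimes>\<^bsub>G\<^esub> b) ` B" by blast
        qed
        have "(h \<otimes>\<^bsub>?S\<^esub> l) (inv\<^bsub>G\<^esub> a \<otimes>\<^bsub>G\<^esub> k) =
          (\<Oplus>\<^bsub>R\<^esub>c \<in> (\<lambda>b. inv\<^bsub>G\<^esub> a \<otimes>\<^bsub>G\<^esub> b) ` B. h c \<otimes>\<^bsub>R\<^esub> l (inv\<^bsub>G\<^esub> c \<otimes>\<^bsub>G\<^esub> (inv\<^bsub>G\<^esub> a \<otimes>\<^bsub>G\<^esub> k)))"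
          using S a k B sub by (intro mult) auto
        also have "\<dots> = (\<Oplus>\<^bsub>R\<^esub>b\<in>B. h (inv\<^bsub>G\<^esub> a \<otimes>\<^bsub>G\<^esub> b) \<otimes>\<^bsub>R\<^esub>
            l (inv\<^bsub>G\<^esub> (inv\<^bsub>G\<^esub> a \<otimes>\<^bsub>G\<^esub> b) \<otimes>\<^bsub>G\<^esub> (inv\<^bsub>G\<^esub> a \<otimes>\<^bsub>G\<^esub> k)))"
          using S a k B inj by (intro R.finsum_reindex) (auto simp: val subset_iff)
        also have "\<dots> = (\<Oplus>\<^bsub>R\<^esub>b\<in>B. h (inv\<^bsub>G\<^esub> a \<otimes>\<^bsub>G\<^esub> b) \<otimes>\<^bsub>R\<^esub> l (inv\<^bsub>G\<^esub> b \<otimes>\<^bsub>G\<^esub> k))"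
        proof (rule R.finsum_cong')
          fix b assume "b \<in> B"
          then have b: "b \<in> carrier G" using B by auto
          have "inv\<^bsub>G\<^esub> (inv\<^bsub>G\<^esub> a \<otimes>\<^bsub>G\<^esub> b) \<otimes>\<^bsub>G\<^esub> (inv\<^bsub>G\<^esub> a \<otimes>\<^bsub>G\<^esub> k) =
            inv\<^bsub>G\<^esub> b \<otimes>\<^bsub>G\<^esub> (a \<otimes>\<^bsub>G\<^esub> inv\<^bsub>G\<^esub> a) \<otimes>\<^bsub>G\<^esub> k"
            using a b k by (simp only: G.inv_mult_group G.inv_inv G.m_assoc G.inv_closed G.m_closed)
          also have "\<dots> = inv\<^bsub>G\<^esub> b \<otimes>\<^bsub>G\<^esub> k" using a b k by simp
          finally show "h (inv\<^bsub>G\<^esub> a \<otimes>\<^bsub>G\<^esub> b) \<otimes>\<^bsub>R\<^esub>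
              l (inv\<^bsub>G\<^esub> (inv\<^bsub>G\<^esub> a \<otimes>\<^bsub>G\<^esub> b) \<otimes>\<^bsub>G\<^esub> (inv\<^bsub>G\<^esub> a \<otimes>\<^bsub>G\<^esub> k)) =
            h (inv\<^bsub>G\<^esub> a \<otimes>\<^bsub>G\<^esub> b) \<otimes>\<^bsub>R\<^esub> l (inv\<^bsub>G\<^esub> b \<otimes>\<^bsub>G\<^esub> k)" by simp
        qed (use S a k B in \<open>auto simp: val subset_iff\<close>)
        finally have "(h \<otimes>\<^bsub>?S\<^esub> l) (inv\<^bsub>G\<^esub> a \<otimes>\<^bsub>G\<^esub> k) = \<dots>" .
        then have "f a \<otimes>\<^bsub>R\<^esub> (h \<otimes>\<^bsub>?S\<^esub> l) (inv\<^bsub>G\<^esub> a \<otimes>\<^bsub>G\<^esub> k) =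
          (\<Oplus>\<^bsub>R\<^esub>b\<in>B. f a \<otimes>\<^bsub>R\<^esub> (h (inv\<^bsub>G\<^esub> a \<otimes>\<^bsub>G\<^esub> b) \<otimes>\<^bsub>R\<^esub> l (inv\<^bsub>G\<^esub> b \<otimes>\<^bsub>G\<^esub> k)))"
          using S a k B by (simp, intro R.finsum_rdistr) (auto simp: val subset_iff)
        then show "(\<Oplus>\<^bsub>R\<^esub>b\<in>B. f a \<otimes>\<^bsub>R\<^esub> (h (inv\<^bsub>G\<^esub> a \<otimes>\<^bsub>G\<^esub> b) \<otimes>\<^bsub>R\<^esub> l (inv\<^bsub>G\<^esub> b \<otimes>\<^bsub>G\<^esub> k))) =
          f a \<otimes>\<^bsub>R\<^esub> (h \<otimes>\<^bsub>?S\<^esub> l) (inv\<^bsub>G\<^esub> a \<otimes>\<^bsub>G\<^esub> k)" by simp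
      qed (use S k multc in \<open>auto simp: val\<close>)
      also have "\<dots> = (f \<otimes>\<^bsub>?S\<^esub> (h \<otimes>\<^bsub>?S\<^esub> l)) k"
        using S k FH by (intro mult[symmetric] multc) auto
      finally show "(f \<otimes>\<^bsub>?S\<^esub> h \<otimes>\<^bsub>?S\<^esub> l) k = (f \<otimes>\<^bsub>?S\<^esub> (h \<otimes>\<^bsub>?S\<^esub> l)) k" .
    qed
  qed (rule multc)
  fix f h l assume S: "f \<in> carrier ?S" "h \<in> carrier ?S" "l \<in> carrier ?S"
  let ?A = "{a \<in> carrier G. f a \<noteq> \<zero>\<^bsub>R\<^esub>} \<union> {a \<in> carrier G. h a \<noteq> \<zero>\<^bsub>R\<^esub>}
    \<union> {a \<in> carrier G. l a \<noteq> \<zero>\<^bsub>R\<^esub>}"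
  have A: "finite ?A" using S supp by auto
  show "(f \<oplus>\<^bsub>?S\<^esub> h) \<otimes>\<^bsub>?S\<^esub> l = f \<otimes>\<^bsub>?S\<^esub> l \<oplus>\<^bsub>?S\<^esub> h \<otimes>\<^bsub>?S\<^esub> l"
  proof (intro eqI multc addc S)
    fix k assume k: "k \<in> carrier G"
    have "((f \<oplus>\<^bsub>?S\<^esub> h) \<otimes>\<^bsub>?S\<^esub> l) k =
      (\<Oplus>\<^bsub>R\<^esub>a\<in>?A. (f \<oplus>\<^bsub>?S\<^esub> h) a \<otimes>\<^bsub>R\<^esub> l (inv\<^bsub>G\<^esub> a \<otimes>\<^bsub>G\<^esub> k))"
      using S k A by (intro mult addc) (auto simp: add)
    also have "\<dots> = (\<Oplus>\<^bsub>R\<^esub>a\<in>?A. f a \<otimes>\<^bsub>R\<^esub> l (inv\<^bsub>G\<^esub> a \<otimes>\<^bsub>G\<^esub> k) \<oplus>\<^bsub>R\<^esub> h a \<otimes>\<^bsub>R\<^esub> l (inv\<^bsub>G\<^esub> a \<otimes>\<^bsub>G\<^esub> k))"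
      using S k by (intro R.finsum_cong' refl) (auto simp: add val R.l_distr)
    also have "\<dots> = (\<Oplus>\<^bsub>R\<^esub>a\<in>?A. f a \<otimes>\<^bsub>R\<^esub> l (inv\<^bsub>G\<^esub> a \<otimes>\<^bsub>G\<^esub> k)) \<oplus>\<^bsub>R\<^esub> (\<Oplus>\<^bsub>R\<^esub>a\<in>?A. h a \<otimes>\<^bsub>R\<^esub> l (inv\<^bsub>G\<^esub> a \<otimes>\<^bsub>G\<^esub> k))"
      using S k by (intro R.finsum_addf) (auto simp: val)
    also have "(\<Oplus>\<^bsub>R\<^esub>a\<in>?A. f a \<otimes>\<^bsub>R\<^esub> l (inv\<^bsub>G\<^esub> a \<otimes>\<^bsub>G\<^esub> k)) = (f \<otimes>\<^bsub>?S\<^esub> l) k"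
      using S k A by (intro mult[symmetric]) auto
    also have "(\<Oplus>\<^bsub>R\<^esub>a\<in>?A. h a \<otimes>\<^bsub>R\<^esub> l (inv\<^bsub>G\<^esub> a \<otimes>\<^bsub>G\<^esub> k)) = (h \<otimes>\<^bsub>?S\<^esub> l) k"
      using S k A by (intro mult[symmetric]) auto
    finally show "((f \<oplus>\<^bsub>?S\<^esub> h) \<otimes>\<^bsub>?S\<^esub> l) k = (f \<otimes>\<^bsub>?S\<^esub> l \<oplus>\<^bsub>?S\<^esub> h \<otimes>\<^bsub>?S\<^esub> l) k"
      using k by (simp add: add)
  qed
  show "l \<otimes>\<^bsub>?S\<^esub> (f \<oplus>\<^bsub>?S\<^esub> h) = l \<otimes>\<^bsub>?S\<^esub> f \<oplus>\<^bsub>?S\<^esub> l \<otimes>\<^bsub>?S\<^esub> h"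
  proof (intro eqI multc addc S)
    fix k assume k: "k \<in> carrier G"
    have "(l \<otimes>\<^bsub>?S\<^esub> (f \<oplus>\<^bsub>?S\<^esub> h)) k =
      (\<Oplus>\<^bsub>R\<^esub>a\<in>?A. l a \<otimes>\<^bsub>R\<^esub> (f \<oplus>\<^bsub>?S\<^esub> h) (inv\<^bsub>G\<^esub> a \<otimes>\<^bsub>G\<^esub> k))"
      using S k A by (intro mult addc) auto
    also have "\<dots> = (\<Oplus>\<^bsub>R\<^esub>a\<in>?A. l a \<otimes>\<^bsub>R\<^esub> f (inv\<^bsub>G\<^esub> a \<otimes>\<^bsub>G\<^esub> k) \<oplus>\<^bsub>R\<^esub> l a \<otimes>\<^bsub>R\<^esub> h (inv\<^bsub>G\<^esub> a \<otimes>\<^bsub>G\<^esub> k))"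
      using S k by (intro R.finsum_cong' refl) (auto simp: add val R.r_distr)
    also have "\<dots> = (\<Oplus>\<^bsub>R\<^esub>a\<in>?A. l a \<otimes>\<^bsub>R\<^esub> f (inv\<^bsub>G\<^esub> a \<otimes>\<^bsub>G\<^esub> k)) \<oplus>\<^bsub>R\<^esub> (\<Oplus>\<^bsub>R\<^esub>a\<in>?A. l a \<otimes>\<^bsub>R\<^esub> h (inv\<^bsub>G\<^esub> a \<otimes>\<^bsub>G\<^esub> k))"
      using S k by (intro R.finsum_addf) (auto simp: val)
    also have "(\<Oplus>\<^bsub>R\<^esub>a\<in>?A. l a \<otimes>\<^bsub>R\<^esub> f (inv\<^bsub>G\<^esub> a \<otimes>\<^bsub>G\<^esub> k)) = (l \<otimes>\<^bsub>?S\<^esub> f) k"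
      using S k A by (intro mult[symmetric]) auto
    also have "(\<Oplus>\<^bsub>R\<^esub>a\<in>?A. l a \<otimes>\<^bsub>R\<^esub> h (inv\<^bsub>G\<^esub> a \<otimes>\<^bsub>G\<^esub> k)) = (l \<otimes>\<^bsub>?S\<^esub> h) k"
      using S k A by (intro mult[symmetric]) auto
    finally show "(l \<otimes>\<^bsub>?S\<^esub> (f \<oplus>\<^bsub>?S\<^esub> h)) k = (l \<otimes>\<^bsub>?S\<^esub> f \<oplus>\<^bsub>?S\<^esub> l \<otimes>\<^bsub>?S\<^esub> h) k"
      using k by (simp add: add)
  qed
qed

end

theory Submission
  imports Defs
begin

text \<open>
  Centrality of \<open>\<phi>\<close> has two consequences: \<open>\<phi> (h\<inverse> g h) = \<phi> g\<close>, and acting by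
  \<open>\<phi> g\<close> commutes with acting by any \<open>h\<close>.  In the generalized Alexander case these reduce
  every axiom to a computation in the group \<open>X\<close>, where the point is that
  \<open>(x \<^bold>\<star>\<^sub>h z) (y \<^bold>\<star>\<^sub>h z)\<inverse> = (x y\<inverse>)\<^sup>h\<close> for the lower operation \<open>\<^bold>\<star>\<^sub>h\<close>.
  The Alexander case is the special case of the additive group of the module, since
  \<open>x g + y (\<phi> g - g) = (x - y) g + y (\<phi> g)\<close>.
\<close>

context group
begin

lemma hom_center_closed:
  assumes "\<phi> \<in> hom G (G\<lparr>carrier := group_center G\<rparr>)" "g \<in> carrier G"
  shows "\<phi> g \<in> carrier G"
  using assms by (auto simp: hom_def group_center_def)

lemma hom_center_commute:
  assumes "\<phi> \<in> hom G (G\<lparr>carrier := group_center G\<rparr>)" "g \<in> carrier G" "h \<in> carrier G"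
  shows "\<phi> g \<otimes> h = h \<otimes> \<phi> g"
  using assms by (auto simp: hom_def group_center_def)

lemma hom_center_mult:
  assumes "\<phi> \<in> hom G (G\<lparr>carrier := group_center G\<rparr>)" "g \<in> carrier G" "h \<in> carrier G"
  shows "\<phi> (g \<otimes> h) = \<phi> g \<otimes> \<phi> h"
  using assms by (auto simp: hom_def)

text \<open>Multiplicativity makes \<open>\<phi> \<one>\<close> idempotent. Arguing this way avoids
  having to show first that the center is itself a group.\<close>

lemma hom_center_one:
  assumes "\<phi> \<in> hom G (G\<lparr>carrier := group_center G\<rparr>)"
  shows "\<phi> \<one> = \<one>"
  using hom_center_mult[OF assms, of \<one> \<one>] hom_center_closed[OF assms, of \<one>] by simp

lemma hom_center_conj:
  assumes \<phi>: "\<phi> \<in> hom G (G\<lparr>carrier := group_center G\<rparr>)"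
    and g: "g \<in> carrier G" and h: "h \<in> carrier G"
  shows "\<phi> (inv h \<otimes> g \<otimes> h) = \<phi> g"
proof -
  \<comment> \<open>The flipped instance of \<open>m_assoc\<close> regroups
    \<open>\<phi> (inv h)\<close> with \<open>\<phi> g\<close>, so that centrality can move
    \<open>\<phi> g\<close> to the front.\<close>
  have "\<phi> (inv h \<otimes> g \<otimes> h) = \<phi> g \<otimes> (\<phi> (inv h) \<otimes> \<phi> h)"
    using g h
    by (simp add: hom_center_mult[OF \<phi>] hom_center_closed[OF \<phi>] m_assoc
        hom_center_commute[OF \<phi>, of "inv h" "\<phi> g"] flip: m_assoc[of "\<phi> (inv h)" "\<phi> g"])
  also have "\<phi> (inv h) \<otimes> \<phi> h = \<one>"
    using h hom_center_mult[OF \<phi>, of "inv h" h] by (simp add: hom_center_one[OF \<phi>])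
  finally show ?thesis using g by (simp add: hom_center_closed[OF \<phi>])
qed

end

context right_action_on_group
begin

text \<open>By \<open>act_hom\<close> the image of the unit is idempotent, hence the unit. The
  diagonal axiom needs this for the factor coming from \<open>x\<close> times its inverse.\<close>

lemma act_group_one:
  assumes "g \<in> carrier G"
  shows "act \<one>\<^bsub>X\<^esub> g = \<one>\<^bsub>X\<^esub>"
  using assms act_hom[of "\<one>\<^bsub>X\<^esub>" "\<one>\<^bsub>X\<^esub>" g] act_closed[of "\<one>\<^bsub>X\<^esub>" g] by simp

lemma act_inv:
  assumes "x \<in> carrier X" "g \<in> carrier G"
  shows "act (inv\<^bsub>X\<^esub> x) g = inv\<^bsub>X\<^esub> (act x g)"
  using assms act_hom[of "inv\<^bsub>X\<^esub> x" x g]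
  by (intro X.inv_equality[symmetric]) (auto simp: act_closed act_group_one)

lemma act_hom_center_commute:
  assumes "\<phi> \<in> hom G (G\<lparr>carrier := group_center G\<rparr>)"
    and "x \<in> carrier X" "g \<in> carrier G" "h \<in> carrier G"
  shows "act (act x (\<phi> g)) h = act (act x h) (\<phi> g)"
  using assms
  by (simp add: act_mult[symmetric] G.hom_center_closed G.hom_center_commute)

lemma generalized_Alexander:
  assumes \<phi>: "\<phi> \<in> hom G (G\<lparr>carrier := group_center G\<rparr>)"
  shows "G_family_of_biquandles G (carrier X)
    (\<lambda>g x y. act (x \<otimes>\<^bsub>X\<^esub> inv\<^bsub>X\<^esub> y) g \<otimes>\<^bsub>X\<^esub> act y (\<phi> g))
    (\<lambda>g x y. act x (\<phi> g))"
proof -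
  \<comment> \<open>\<open>X\<close> need not be commutative, so cancellation relies on the common
    factor standing on the right. The next fact is the case where \<open>w\<close> is the inverse of
    \<open>z\<close>.\<close>
  have cancel: "x \<otimes>\<^bsub>X\<^esub> w \<otimes>\<^bsub>X\<^esub> inv\<^bsub>X\<^esub> (y \<otimes>\<^bsub>X\<^esub> w) = x \<otimes>\<^bsub>X\<^esub> inv\<^bsub>X\<^esub> y"
    if "x \<in> carrier X" "y \<in> carrier X" "w \<in> carrier X" for x y w
    using that by (simp add: X.inv_mult_group X.m_assoc) (simp flip: X.m_assoc)
  have insert: "x \<otimes>\<^bsub>X\<^esub> inv\<^bsub>X\<^esub> z \<otimes>\<^bsub>X\<^esub> inv\<^bsub>X\<^esub> (y \<otimes>\<^bsub>X\<^esub> inv\<^bsub>X\<^esub> z) = x \<otimes>\<^bsub>X\<^esub> inv\<^bsub>X\<^esub> y"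
    if "x \<in> carrier X" "y \<in> carrier X" "z \<in> carrier X" for x y z
    using that cancel by simp
  \<comment> \<open>This accounts for the conjugated index in the axioms: \<open>h\<close> followed
    by \<open>inv h g h\<close> multiplies to \<open>g h\<close>.\<close>
  have conj: "act (act x h) (inv\<^bsub>G\<^esub> h \<otimes>\<^bsub>G\<^esub> g \<otimes>\<^bsub>G\<^esub> h) = act (act x g) h"
    if "x \<in> carrier X" "g \<in> carrier G" "h \<in> carrier G" for x g h
  proof -
    have "h \<otimes>\<^bsub>G\<^esub> (inv\<^bsub>G\<^esub> h \<otimes>\<^bsub>G\<^esub> g \<otimes>\<^bsub>G\<^esub> h) = g \<otimes>\<^bsub>G\<^esub> h"
      using that by (simp flip: G.m_assoc)
    then show ?thesis using that by (simp flip: act_mult)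
  qed
  note [simp] = act_closed act_hom act_inv G.hom_center_closed[OF \<phi>]
    G.hom_center_conj[OF \<phi>]
  note comm = act_hom_center_commute[OF \<phi>]
  \<comment> \<open>First the common factor \<open>act z (\<phi> h)\<close> cancels, while the
    products inside \<open>act _ h\<close> are still intact; then the contribution of the inverse of
    \<open>z\<close> cancels.\<close>
  have under_diff: "act (x \<otimes>\<^bsub>X\<^esub> inv\<^bsub>X\<^esub> z) h \<otimes>\<^bsub>X\<^esub> act z (\<phi> h) \<otimes>\<^bsub>X\<^esub>
      inv\<^bsub>X\<^esub> (act (y \<otimes>\<^bsub>X\<^esub> inv\<^bsub>X\<^esub> z) h \<otimes>\<^bsub>X\<^esub> act z (\<phi> h)) = act (x \<otimes>\<^bsub>X\<^esub> inv\<^bsub>X\<^esub> y) h"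
    if "x \<in> carrier X" "y \<in> carrier X" "z \<in> carrier X" "h \<in> carrier G" for x y z h
    using that by (simp only: cancel act_closed X.m_closed X.inv_closed G.hom_center_closed[OF \<phi>])
      (simp add: insert)
  show ?thesis
  proof
    show "carrier X \<noteq> {}" using X.one_closed by blast
  next
    \<comment> \<open>Axiom \<open>under_under\<close>. \<open>under_diff\<close> is unfolded before
      the simplifier can expand the action over products. The two instances of \<open>comm\<close>
      fix an order of the exponents: \<open>h\<close>, then \<open>\<phi> g\<close>, then
      \<open>\<phi> h\<close>. In general form \<open>comm\<close> could swap two exponents from the
      image of \<open>\<phi>\<close> back and forth.\<close>
    fix g h x y z
    assume *: "g \<in> carrier G" "h \<in> carrier G" "x \<in> carrier X" "y \<in> carrier X" "z \<in> carrier X"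
    have "act (act (x \<otimes>\<^bsub>X\<^esub> inv\<^bsub>X\<^esub> y) h) (inv\<^bsub>G\<^esub> h \<otimes>\<^bsub>G\<^esub> g \<otimes>\<^bsub>G\<^esub> h) =
      act (act (x \<otimes>\<^bsub>X\<^esub> inv\<^bsub>X\<^esub> y) g) h" using * by (intro conj) auto
    then show "act (act (x \<otimes>\<^bsub>X\<^esub> inv\<^bsub>X\<^esub> y) g \<otimes>\<^bsub>X\<^esub> act y (\<phi> g) \<otimes>\<^bsub>X\<^esub> inv\<^bsub>X\<^esub> act z (\<phi> g)) h \<otimes>\<^bsub>X\<^esub>
        act (act z (\<phi> g)) (\<phi> h) =
      act (act (x \<otimes>\<^bsub>X\<^esub> inv\<^bsub>X\<^esub> z) h \<otimes>\<^bsub>X\<^esub> act z (\<phi> h) \<otimes>\<^bsub>X\<^esub>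
        inv\<^bsub>X\<^esub> (act (y \<otimes>\<^bsub>X\<^esub> inv\<^bsub>X\<^esub> z) h \<otimes>\<^bsub>X\<^esub> act z (\<phi> h))) (inv\<^bsub>G\<^esub> h \<otimes>\<^bsub>G\<^esub> g \<otimes>\<^bsub>G\<^esub> h) \<otimes>\<^bsub>X\<^esub>
        act (act (y \<otimes>\<^bsub>X\<^esub> inv\<^bsub>X\<^esub> z) h \<otimes>\<^bsub>X\<^esub> act z (\<phi> h)) (\<phi> (inv\<^bsub>G\<^esub> h \<otimes>\<^bsub>G\<^esub> g \<otimes>\<^bsub>G\<^esub> h))"
      unfolding under_diff[OF *(3,4,5,2)] using *
      by (simp add: X.m_assoc comm[of _ g h] comm[of _ h "\<phi> g"])
  next
    \<comment> \<open>Axiom \<open>over_under\<close>, with the same order of exponents.\<close>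
    fix g h x y z
    assume "g \<in> carrier G" "h \<in> carrier G" "x \<in> carrier X" "y \<in> carrier X" "z \<in> carrier X"
    then show "act (act x (\<phi> g) \<otimes>\<^bsub>X\<^esub> inv\<^bsub>X\<^esub> act z (\<phi> g)) h \<otimes>\<^bsub>X\<^esub> act (act z (\<phi> g)) (\<phi> h) =
      act (act (x \<otimes>\<^bsub>X\<^esub> inv\<^bsub>X\<^esub> z) h \<otimes>\<^bsub>X\<^esub> act z (\<phi> h)) (\<phi> (inv\<^bsub>G\<^esub> h \<otimes>\<^bsub>G\<^esub> g \<otimes>\<^bsub>G\<^esub> h))"
      by (simp add: comm[of _ g h] comm[of _ h "\<phi> g"])
  next
    \<comment> \<open>Axiom \<open>over_over\<close>. Only \<open>x\<close> occurs because the upper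
      operation ignores its second argument.\<close>
    fix g h x
    assume "g \<in> carrier G" "h \<in> carrier G" "x \<in> carrier X"
    then show "act (act x (\<phi> g)) (\<phi> h) = act (act x (\<phi> h)) (\<phi> (inv\<^bsub>G\<^esub> h \<otimes>\<^bsub>G\<^esub> g \<otimes>\<^bsub>G\<^esub> h))"
      by (simp add: comm[of _ h "\<phi> g"])
  next
    \<comment> \<open>Axiom \<open>under_mult\<close>. Here the lower operation at \<open>y\<close>,
      \<open>y\<close> gives just \<open>act y (\<phi> g)\<close>, which cancels against the last
      factor of the operation at \<open>x\<close>, \<open>y\<close>.\<close>
    fix g h x y
    assume "g \<in> carrier G" "h \<in> carrier G" "x \<in> carrier X" "y \<in> carrier X"
    then show "act (x \<otimes>\<^bsub>X\<^esub> inv\<^bsub>X\<^esub> y) (g \<otimes>\<^bsub>G\<^esub> h) \<otimes>\<^bsub>X\<^esub> act y (\<phi> (g \<otimes>\<^bsub>G\<^esub> h)) =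
      act (act (x \<otimes>\<^bsub>X\<^esub> inv\<^bsub>X\<^esub> y) g \<otimes>\<^bsub>X\<^esub> act y (\<phi> g) \<otimes>\<^bsub>X\<^esub>
        inv\<^bsub>X\<^esub> (act (y \<otimes>\<^bsub>X\<^esub> inv\<^bsub>X\<^esub> y) g \<otimes>\<^bsub>X\<^esub> act y (\<phi> g))) h \<otimes>\<^bsub>X\<^esub>
        act (act (y \<otimes>\<^bsub>X\<^esub> inv\<^bsub>X\<^esub> y) g \<otimes>\<^bsub>X\<^esub> act y (\<phi> g)) (\<phi> h)"
      by (simp add: X.m_assoc act_mult act_group_one G.hom_center_mult[OF \<phi>])
  qed (auto simp: X.m_assoc act_one act_mult act_group_one G.hom_center_one[OF \<phi>] G.hom_center_mult[OF \<phi>])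
qed

end

text \<open>Every axiom evaluates the operations on \<open>X\<close> only, nested values included by
  closure. This allows replacing a formula by one that agrees with it only on the carrier.\<close>

lemma (in G_family_of_biquandles) cong:
  assumes under: "\<And>g x y. \<lbrakk>g \<in> carrier G; x \<in> X; y \<in> X\<rbrakk> \<Longrightarrow> under' g x y = under g x y"
    and over: "\<And>g x y. \<lbrakk>g \<in> carrier G; x \<in> X; y \<in> X\<rbrakk> \<Longrightarrow> over' g x y = over g x y"
  shows "G_family_of_biquandles G X under' over'"
  by unfold_locales
    (simp_all add: under over under_closed over_closed nonempty under_one over_one,
      (rule under_under over_under over_over under_mult over_mult under_over_diag; assumption)+)

context right_module
begin

text \<open>Additivity is applied to \<open>a = (a - b) + b\<close> and one summand is cancelled in
  \<open>M\<close>, so zero and negative scalars need no separate treatment.\<close>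

lemma rsmult_diff_right:
  assumes "x \<in> carrier M" "a \<in> carrier R" "b \<in> carrier R"
  shows "rsmult x (a \<ominus>\<^bsub>R\<^esub> b) = rsmult x a \<ominus>\<^bsub>M\<^esub> rsmult x b"
proof -
  have "rsmult x a = rsmult x ((a \<ominus>\<^bsub>R\<^esub> b) \<oplus>\<^bsub>R\<^esub> b)"
    using assms by (simp add: R.minus_eq R.a_assoc R.l_neg)
  also have "\<dots> = rsmult x (a \<ominus>\<^bsub>R\<^esub> b) \<oplus>\<^bsub>M\<^esub> rsmult x b"
    using assms by (intro rsmult_add_right) auto
  finally show ?thesis
    using assms by (simp add: rsmult_closed M.minus_eq M.a_assoc M.r_neg)
qed

lemma rsmult_diff_left:
  assumes "x \<in> carrier M" "y \<in> carrier M" "a \<in> carrier R"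
  shows "rsmult (x \<ominus>\<^bsub>M\<^esub> y) a = rsmult x a \<ominus>\<^bsub>M\<^esub> rsmult y a"
proof -
  have "rsmult x a = rsmult ((x \<ominus>\<^bsub>M\<^esub> y) \<oplus>\<^bsub>M\<^esub> y) a"
    using assms by (simp add: M.minus_eq M.a_assoc M.l_neg)
  also have "\<dots> = rsmult (x \<ominus>\<^bsub>M\<^esub> y) a \<oplus>\<^bsub>M\<^esub> rsmult y a"
    using assms by (intro rsmult_add_left) auto
  finally show ?thesis
    using assms by (simp add: rsmult_closed M.minus_eq M.a_assoc M.r_neg)
qed

end

text \<open>Scalars are restricted along the multiplicative map \<open>gr_elem R G\<close>;
  additivity of \<open>rsmult\<close> in its first argument is exactly \<open>act_hom\<close> for
  the additive group.\<close>

lemma group_ring_module_right_action: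
  assumes "ring R" "group G" "right_module (group_ring R G) M rsmult"
  shows "right_action_on_group G (add_monoid M) (\<lambda>x g. rsmult x (gr_elem R G g))"
proof -
  interpret G: group G by fact
  interpret M: right_module "group_ring R G" M rsmult by fact
  interpret A: group "add_monoid M" by (rule M.M.a_group)
  note closed = gr_elem_closed[OF assms(1)]
  show ?thesis
  proof
    fix x assume "x \<in> carrier (add_monoid M)"
    then show "rsmult x (gr_elem R G \<one>\<^bsub>G\<^esub>) = x"
      using M.rsmult_one by (simp add: group_ring_def)
  qed (auto simp: closed M.rsmult_closed M.rsmult_add_left
      M.rsmult_mult gr_elem_mult[OF assms(1,2), symmetric])
qed

lemma Alexander:
  assumes "ring R" "group G" "right_module (group_ring R G) M rsmult"
    and \<phi>: "\<phi> \<in> hom G (G\<lparr>carrier := group_center G\<rparr>)"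
  shows "G_family_of_biquandles G (carrier M)
    (\<lambda>g x y. rsmult x (gr_elem R G g) \<oplus>\<^bsub>M\<^esub>
             rsmult y (gr_elem R G (\<phi> g) \<ominus>\<^bsub>group_ring R G\<^esub> gr_elem R G g))
    (\<lambda>g x y. rsmult x (gr_elem R G (\<phi> g)))"
proof -
  interpret M: right_module "group_ring R G" M rsmult by fact
  interpret act: right_action_on_group G "add_monoid M" "\<lambda>x g. rsmult x (gr_elem R G g)"
    using assms(1-3) by (rule group_ring_module_right_action)
  note closed = gr_elem_closed[OF assms(1)]
  \<comment> \<open>Free of carrier hypotheses, so it can be unfolded under the abstractions of the
    operations.\<close>
  have diff: "x \<otimes>\<^bsub>add_monoid M\<^esub> inv\<^bsub>add_monoid M\<^esub> y = x \<ominus>\<^bsub>M\<^esub> y" for x y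
    by (simp add: a_minus_def a_inv_def)
  show ?thesis
  proof (rule G_family_of_biquandles.cong[OF act.generalized_Alexander[OF \<phi>, unfolded diff], simplified])
    \<comment> \<open>After distributing, both sides are the sum of \<open>x g\<close>,
      \<open>y (\<phi> g)\<close> and \<open>- y g\<close>, in different orders.\<close>
    fix g x y
    assume "x \<in> carrier M" "y \<in> carrier M"
    then show "rsmult x (gr_elem R G g) \<oplus>\<^bsub>M\<^esub>
        rsmult y (gr_elem R G (\<phi> g) \<ominus>\<^bsub>group_ring R G\<^esub> gr_elem R G g) =
      rsmult (x \<ominus>\<^bsub>M\<^esub> y) (gr_elem R G g) \<oplus>\<^bsub>M\<^esub> rsmult y (gr_elem R G (\<phi> g))"
      by (simp add: closed M.rsmult_closed M.rsmult_diff_right M.rsmult_diff_left)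
        (simp add: closed M.rsmult_closed M.M.minus_eq M.M.a_ac)
  qed simp
qed

theorem proposition3p5:
  fixes G :: "('g, 'm) monoid_scheme" and \<phi> :: "'g \<Rightarrow> 'g"
  assumes "group G"
    and "\<phi> \<in> hom G (G\<lparr>carrier := group_center G\<rparr>)"
  shows
    "(\<forall>(X :: ('x, 'n) monoid_scheme) (act :: 'x \<Rightarrow> 'g \<Rightarrow> 'x).
        right_action_on_group G X act \<longrightarrow>
        G_family_of_biquandles G (carrier X)
          (\<lambda>g x y. act (x \<otimes>\<^bsub>X\<^esub> inv\<^bsub>X\<^esub> y) g \<otimes>\<^bsub>X\<^esub> act y (\<phi> g))
          (\<lambda>g x y. act x (\<phi> g)))
     \<and>
     (\<forall>(R :: ('r, 'k) ring_scheme) (X :: ('y, 'l) ring_scheme)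
        (rsmult :: 'y \<Rightarrow> ('g \<Rightarrow> 'r) \<Rightarrow> 'y).
        ring R \<and> right_module (group_ring R G) X rsmult \<longrightarrow>
        G_family_of_biquandles G (carrier X)
          (\<lambda>g x y. rsmult x (gr_elem R G g) \<oplus>\<^bsub>X\<^esub>
                   rsmult y (gr_elem R G (\<phi> g) \<ominus>\<^bsub>group_ring R G\<^esub> gr_elem R G g))
          (\<lambda>g x y. rsmult x (gr_elem R G (\<phi> g))))"
proof (intro conjI allI impI)
  fix X :: "('x, 'n) monoid_scheme" and act :: "'x \<Rightarrow> 'g \<Rightarrow> 'x"
  assume "right_action_on_group G X act"
  then show "G_family_of_biquandles G (carrier X)
      (\<lambda>g x y. act (x \<otimes>\<^bsub>X\<^esub> inv\<^bsub>X\<^esub> y) g \<otimes>\<^bsub>X\<^esub> act y (\<phi> g))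
      (\<lambda>g x y. act x (\<phi> g))"
    by (rule right_action_on_group.generalized_Alexander) (rule assms(2))
next
  fix R :: "('r, 'k) ring_scheme" and X :: "('y, 'l) ring_scheme"
    and rsmult :: "'y \<Rightarrow> ('g \<Rightarrow> 'r) \<Rightarrow> 'y"
  assume R: "ring R \<and> right_module (group_ring R G) X rsmult"
  show "G_family_of_biquandles G (carrier X)
      (\<lambda>g x y. rsmult x (gr_elem R G g) \<oplus>\<^bsub>X\<^esub>
               rsmult y (gr_elem R G (\<phi> g) \<ominus>\<^bsub>group_ring R G\<^esub> gr_elem R G g))
      (\<lambda>g x y. rsmult x (gr_elem R G (\<phi> g)))"
    by (rule Alexander[OF conjunct1[OF R] assms(1) conjunct2[OF R] assms(2)])
qed

end
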